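(* Let $n\ge 1$ be an integer. For each $(a_0,\dots,a_{n-1})\in\{-1,+1\}^n$, extended to an infinite sequence by $a_{n+k}=a_k$ for all $k\ge 0$, let $x(a_0,\dots,a_{n-1})$ denote the value (limit) of the continued radical $$a_0\sqrt{2+a_1\sqrt{2+a_2\sqrt{2+a_3\sqrt{2+\cdots}}}},$$ which exists. Then the values of these continued radicals are exactly two times the fixed points of the Chebyshev polynomial $T_{2^n}$, that is, $$\{x(a_0,\dots,a_{n-1}) : (a_0,\dots,a_{n-1})\in\{-1,+1\}^n\} = \{2t : t\in\mathbb{R},\ T_{2^n}(t)=t\}.$$
   Context: For a sequence $(a_k)_{k\ge0}$ with $a_k\in\{-1,+1\}$, the continued radical $a_0\sqrt{2+a_1\sqrt{2+a_2\sqrt{2+\cdots}}}$ means the limit as $m\to\infty$ of the finite nested radicals $$x_m = a_0\sqrt{2+a_1\sqrt{2+a_2\sqrt{2+\cdots+a_{m-1}\sqrt{2}}}},\qquad m\ge 1,$$ with $x_1=a_0\sqrt2$. The integer $n$ is a period of the sign sequence but need not be the minimal one. $T_N$ denotes the $N$th Chebyshev polynomial of the first kind, the polynomial satisfying $T_N(\cos\theta)=\cos(N\theta)$ for all real $\theta$. *)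

theory Defs
  imports "HOL-Analysis.Analysis" "HOL-Computational_Algebra.Polynomial"
begin

(* For m >= 1, nested_radical a m is x_m = a_0 sqrt(2 + a_1 sqrt(2 + ... + a_(m-1) sqrt 2));
   x_0 = 0 is a convention. The recursion peels off the outermost radical by shifting a. *)
fun nested_radical :: "(nat \<Rightarrow> real) \<Rightarrow> nat \<Rightarrow> real" where
  "nested_radical a 0 = 0"
| "nested_radical a (Suc m) = a 0 * sqrt (2 + nested_radical (\<lambda>k. a (Suc k)) m)"

lemma nested_radical_1: "nested_radical a 1 = a 0 * sqrt 2"
  by simp

lemma nested_radical_3:
  "nested_radical a 3 = a 0 * sqrt (2 + a 1 * sqrt (2 + a 2 * sqrt 2))"
  by (simp add: numeral_eq_Suc)

(* sqrt of a negative real is a nonzero junk value in HOL; this rules it out for sign sequences. *)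
lemma nested_radical_bound:
  assumes "\<And>k. a k \<in> {- 1, 1}"
  shows "\<bar>nested_radical a m\<bar> \<le> 2"
  using assms
proof (induction m arbitrary: a)
  case 0
  then show ?case by simp
next
  case (Suc m)
  have "\<bar>nested_radical (\<lambda>k. a (Suc k)) m\<bar> \<le> 2"
    using Suc.prems by (intro Suc.IH)
  then have "0 \<le> 2 + nested_radical (\<lambda>k. a (Suc k)) m"
    and "2 + nested_radical (\<lambda>k. a (Suc k)) m \<le> 2\<^sup>2"
    by auto
  then have "\<bar>sqrt (2 + nested_radical (\<lambda>k. a (Suc k)) m)\<bar> \<le> 2"
    by (simp add: real_le_lsqrt)
  moreover have "\<bar>a 0\<bar> = 1"
    using Suc.prems[of 0] by auto
  ultimately show ?case
    by (simp add: abs_mult)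
qed

(* Only meaningful when the finite radicals converge. *)
definition continued_radical :: "(nat \<Rightarrow> real) \<Rightarrow> real" where
  "continued_radical a = lim (nested_radical a)"

definition sign_tuples :: "nat \<Rightarrow> (nat \<Rightarrow> real) set" where
  "sign_tuples n = {..<n} \<rightarrow>\<^sub>E {- 1, 1}"

definition periodic_extension :: "nat \<Rightarrow> (nat \<Rightarrow> real) \<Rightarrow> nat \<Rightarrow> real" where
  "periodic_extension n a k = a (k mod n)"

lemma periodic_extension_less: "k < n \<Longrightarrow> periodic_extension n a k = a k"
  by (simp add: periodic_extension_def)

lemma periodic_extension_add: "periodic_extension n a (n + k) = periodic_extension n a k"
  by (simp add: periodic_extension_def)

definition Chebyshev_T :: "nat \<Rightarrow> real poly" where
  "Chebyshev_T N = (THE p. \<forall>\<theta>. poly p (cos \<theta>) = cos (real N * \<theta>))"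

lemma Chebyshev_T_ex1: "\<exists>!p :: real poly. \<forall>\<theta>. poly p (cos \<theta>) = cos (real N * \<theta>)"
proof (rule ex_ex1I)
  have "\<exists>p q :: real poly. (\<forall>\<theta>. poly p (cos \<theta>) = cos (real N * \<theta>)) \<and>
    (\<forall>\<theta>. poly q (cos \<theta>) = cos (real (Suc N) * \<theta>))"
  proof (induction N)
    case 0
    show ?case
      by (intro exI[of _ 1] exI[of _ "[:0, 1:]"]) simp
  next
    case (Suc N)
    then obtain p q :: "real poly"
      where p: "\<And>\<theta>. poly p (cos \<theta>) = cos (real N * \<theta>)"
        and q: "\<And>\<theta>. poly q (cos \<theta>) = cos (real (Suc N) * \<theta>)"
      by blast
    have "poly ([:0, 2:] * q - p) (cos \<theta>) = cos (real (Suc (Suc N)) * \<theta>)" for \<theta>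
    proof -
      have "cos (real (Suc N) * \<theta> + \<theta>) + cos (real (Suc N) * \<theta> - \<theta>)
          = 2 * cos \<theta> * cos (real (Suc N) * \<theta>)"
        unfolding cos_add cos_diff by simp
      moreover have "real (Suc N) * \<theta> + \<theta> = real (Suc (Suc N)) * \<theta>"
        "real (Suc N) * \<theta> - \<theta> = real N * \<theta>"
        by (simp_all add: algebra_simps)
      ultimately show ?thesis
        by (simp add: p q)
    qed
    with q show ?case by blast
  qed
  then show "\<exists>p :: real poly. \<forall>\<theta>. poly p (cos \<theta>) = cos (real N * \<theta>)"
    by blast
next
  fix p q :: "real poly"
  assume p: "\<forall>\<theta>. poly p (cos \<theta>) = cos (real N * \<theta>)"
    and q: "\<forall>\<theta>. poly q (cos \<theta>) = cos (real N * \<theta>)"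
  have "{- 1..1} \<subseteq> {x. poly (p - q) x = 0}"
  proof
    fix x :: real
    assume "x \<in> {- 1..1}"
    then have "cos (arccos x) = x" by simp
    moreover have "poly p (cos (arccos x)) = poly q (cos (arccos x))"
      by (simp only: p q)
    ultimately show "x \<in> {x. poly (p - q) x = 0}" by simp
  qed
  moreover have "infinite {- 1..1 :: real}"
    by (simp add: infinite_Icc)
  ultimately have "infinite {x. poly (p - q) x = 0}"
    using finite_subset by blast
  then show "p = q"
    using poly_roots_finite[of "p - q"] by auto
qed

lemma Chebyshev_T_cos: "poly (Chebyshev_T N) (cos \<theta>) = cos (real N * \<theta>)"
  using theI'[OF Chebyshev_T_ex1[of N]] unfolding Chebyshev_T_def by blast

end

(* Writing x = 2 cos \<theta> with \<theta> in [0, pi], the map x \<mapsto> s sqrt (2 + x) becomes \<theta> \<mapsto> \<theta>/2 (s = 1) or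
   \<theta> \<mapsto> pi - \<theta>/2 (s = -1), a contraction by 1/2. So the nested radicals converge, and any
   bounded solution of x_k = a_k sqrt (2 + x_(k+1)) has x_0 as the value of the radical. A branch
   of the inverse of P(x) = x^2 - 2 has been applied at each step, so radicals of period n are
   fixed points of P^n, which is T_(2^n) conjugated by t \<mapsto> 2 t; conversely, the signs of the orbit
   of such a fixed point form an n-periodic sequence whose radical it is. *)
theory Submission
  imports Defs
begin

text \<open>Half-angle formula: if u = 2 cos \<phi>, then 2 + u = (2 cos (\<phi>/2))^2, and \<phi>/2
  lies in [0, pi/2], where cos is nonnegative. The sign -1 turns \<phi>/2 into pi -
  \<phi>/2.\<close>

lemma arccos_half_radical:
  fixes s u :: real
  assumes "s \<in> {- 1, 1}" "\<bar>u\<bar> \<le> 2"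
  shows "arccos (s * sqrt (2 + u) / 2) =
    (if s = 1 then arccos (u / 2) / 2 else pi - arccos (u / 2) / 2)"
proof -
  define \<phi> where "\<phi> = arccos (u / 2)"
  have \<phi>: "0 \<le> \<phi>" "\<phi> \<le> pi" "u = 2 * cos \<phi>"
    using assms(2) by (auto simp: \<phi>_def intro: arccos_lbound arccos_ubound)
  have "cos \<phi> = 2 * (cos (\<phi> / 2))\<^sup>2 - 1"
    using cos_double_cos[of "\<phi> / 2"] by simp
  then have "2 + u = (2 * cos (\<phi> / 2))\<^sup>2"
    using \<phi>(3) by (simp add: power_mult_distrib)
  moreover have "0 \<le> cos (\<phi> / 2)"
    using \<phi> by (intro cos_ge_zero) auto
  ultimately have root: "sqrt (2 + u) = 2 * cos (\<phi> / 2)"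
    by (intro real_sqrt_unique) auto
  have "arccos (cos (\<phi> / 2)) = \<phi> / 2" "arccos (cos (pi - \<phi> / 2)) = pi - \<phi> / 2"
    using \<phi>(1,2) by (intro arccos_cos; simp)+
  then show ?thesis
    using assms(1) root unfolding \<phi>_def by auto
qed

text \<open>The recursion for \<open>x\<close> is assumed only below \<open>m\<close>, so
  \<open>x\<close> may be an infinite solution or the list of inner radicals of a longer finite
  radical.\<close>

lemma arccos_nested_radical_dist:
  fixes a x :: "nat \<Rightarrow> real"
  assumes "\<And>k. a k \<in> {- 1, 1}"
    and "\<And>k. k \<le> m \<Longrightarrow> \<bar>x k\<bar> \<le> 2"
    and "\<And>k. k < m \<Longrightarrow> x k = a k * sqrt (2 + x (Suc k))"
  shows "\<bar>arccos (x 0 / 2) - arccos (nested_radical a m / 2)\<bar> \<le> pi / 2 ^ m"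
  using assms
proof (induction m arbitrary: a x)
  case 0
  \<comment> \<open>The empty radical 0 has angle pi/2, so any angle in [0, pi] is within pi/2 of
    it.\<close>
  have "0 \<le> arccos (x 0 / 2)" "arccos (x 0 / 2) \<le> pi"
    using 0(2)[of 0] by (auto intro: arccos_lbound arccos_ubound)
  then show ?case by (simp add: abs_if)
next
  case (Suc m)
  let ?b = "\<lambda>k. a (Suc k)"
  have IH: "\<bar>arccos (x (Suc 0) / 2) - arccos (nested_radical ?b m / 2)\<bar> \<le> pi / 2 ^ m"
    using Suc.IH[of ?b "\<lambda>k. x (Suc k)"] Suc.prems by simp
  have "\<bar>x (Suc 0)\<bar> \<le> 2" and x0: "x 0 = a 0 * sqrt (2 + x (Suc 0))"
    using Suc.prems by auto
  moreover have "\<bar>nested_radical ?b m\<bar> \<le> 2"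
    using Suc.prems(1) by (intro nested_radical_bound)
  moreover have sgn: "a 0 \<in> {- 1, 1}" using Suc.prems(1) .
  \<comment> \<open>Both sides carry the same outer sign \<open>a 0\<close>, so any reflection at pi
    cancels and the angle difference is exactly halved.\<close>
  ultimately have "\<bar>arccos (x 0 / 2) - arccos (nested_radical a (Suc m) / 2)\<bar> =
      \<bar>arccos (x (Suc 0) / 2) - arccos (nested_radical ?b m / 2)\<bar> / 2"
    unfolding x0 nested_radical.simps
    by (simp only: arccos_half_radical) (auto simp: abs_if field_simps)
  also have "\<dots> \<le> pi / 2 ^ m / 2"
    using IH by (rule divide_right_mono) simp
  finally show ?case by (simp add: mult.commute)
qed

text \<open>Returns from angles to values: cos is 1-Lipschitz, and x = 2 cos \<theta> contributes
  the factor 2.\<close>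

lemma nested_radical_dist:
  fixes a x :: "nat \<Rightarrow> real"
  assumes "\<And>k. a k \<in> {- 1, 1}"
    and "\<And>k. k \<le> m \<Longrightarrow> \<bar>x k\<bar> \<le> 2"
    and "\<And>k. k < m \<Longrightarrow> x k = a k * sqrt (2 + x (Suc k))"
  shows "\<bar>x 0 - nested_radical a m\<bar> \<le> 2 * pi / 2 ^ m"
proof -
  have lip: "\<bar>cos p - cos q\<bar> \<le> \<bar>p - q\<bar>" for p q :: real
  proof -
    have "\<bar>cos p - cos q\<bar> = 2 * (\<bar>sin ((p + q) / 2)\<bar> * \<bar>sin ((q - p) / 2)\<bar>)"
      by (simp add: cos_diff_cos abs_mult)
    also have "\<dots> \<le> 2 * (1 * \<bar>(q - p) / 2\<bar>)"
      by (intro mult_left_mono mult_mono abs_sin_le_one abs_sin_x_le_abs_x) auto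
    finally show ?thesis by (simp add: abs_minus_commute)
  qed
  have "\<bar>x 0\<bar> \<le> 2" "\<bar>nested_radical a m\<bar> \<le> 2"
    using assms nested_radical_bound by auto
  then have "x 0 / 2 = cos (arccos (x 0 / 2))"
    "nested_radical a m / 2 = cos (arccos (nested_radical a m / 2))"
    by auto
  then have "\<bar>x 0 / 2 - nested_radical a m / 2\<bar> \<le> pi / 2 ^ m"
    using lip arccos_nested_radical_dist[of a m x, OF assms] by (metis order_trans)
  then show ?thesis by (simp add: mult.commute flip: diff_divide_distrib)
qed

lemma tendsto_two_pi_half_powers: "(\<lambda>m. 2 * pi / 2 ^ m) \<longlonglongrightarrow> 0"
proof -
  have "(\<lambda>m. 2 * pi * (1 / 2) ^ m) \<longlonglongrightarrow> 2 * pi * 0"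
    by (intro tendsto_mult tendsto_const LIMSEQ_power_zero) simp
  then show ?thesis by (simp add: power_divide)
qed

lemma nested_radical_unfold:
  assumes "k < m"
  shows "nested_radical (\<lambda>i. a (k + i)) (m - k) =
    a k * sqrt (2 + nested_radical (\<lambda>i. a (Suc k + i)) (m - Suc k))"
  using assms by (simp add: Suc_diff_Suc[symmetric])

text \<open>A longer radical satisfies the recursion down to the depth of a shorter one, so the two
  are geometrically close and the sequence is Cauchy.\<close>

lemma convergent_nested_radical:
  assumes sgn: "\<And>k. a k \<in> {- 1, 1}"
  shows "convergent (nested_radical a)"
proof -
  have dist: "\<bar>nested_radical a p - nested_radical a m\<bar> \<le> 2 * pi / 2 ^ m" if "m \<le> p" for m p
  proof -
    \<comment> \<open>The successive inner radicals of \<open>nested_radical a p\<close>;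
      \<open>?x 0\<close> is the whole of it.\<close>
    let ?x = "\<lambda>k. nested_radical (\<lambda>i. a (k + i)) (p - k)"
    have "\<bar>?x 0 - nested_radical a m\<bar> \<le> 2 * pi / 2 ^ m"
    proof (rule nested_radical_dist)
      show "\<bar>?x k\<bar> \<le> 2" for k
        using sgn by (rule nested_radical_bound)
      show "?x k = a k * sqrt (2 + ?x (Suc k))" if "k < m" for k
        using \<open>k < m\<close> \<open>m \<le> p\<close> by (intro nested_radical_unfold) simp
    qed (rule sgn)
    then show ?thesis by simp
  qed
  have "Cauchy (nested_radical a)"
  proof (rule metric_CauchyI)
    fix e :: real
    assume "0 < e"
    then obtain N where N: "2 * pi / 2 ^ N < e / 2"
      using order_tendstoD(2)[OF tendsto_two_pi_half_powers, of "e / 2"]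
      by (auto simp: eventually_sequentially)
    have "dist (nested_radical a m) (nested_radical a p) < e" if "N \<le> m" "N \<le> p" for m p
      using dist[OF that(1)] dist[OF that(2)] N by (simp add: dist_real_def)
    then show "\<exists>M. \<forall>m\<ge>M. \<forall>n\<ge>M. dist (nested_radical a m) (nested_radical a n) < e"
      by blast
  qed
  then show ?thesis by (rule Cauchy_convergent)
qed

lemma continued_radical_eqI:
  fixes a x :: "nat \<Rightarrow> real"
  assumes "\<And>k. a k \<in> {- 1, 1}" "\<And>k. \<bar>x k\<bar> \<le> 2"
    and "\<And>k. x k = a k * sqrt (2 + x (Suc k))"
  shows "continued_radical a = x 0"
proof -
  have "\<bar>nested_radical a m - x 0\<bar> \<le> 2 * pi / 2 ^ m" for m
    using nested_radical_dist[of a m x, OF assms] by (simp only: abs_minus_commute)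
  then have "(\<lambda>m. nested_radical a m - x 0) \<longlonglongrightarrow> 0"
    by (intro Lim_null_comparison[OF _ tendsto_two_pi_half_powers]) auto
  then have "nested_radical a \<longlonglongrightarrow> x 0"
    by (simp add: LIM_zero_iff)
  then show ?thesis
    unfolding continued_radical_def by (rule limI)
qed

text \<open>Squaring removes the outermost sign and root of each finite radical; continuity carries
  this to the limit.\<close>

lemma continued_radical_square:
  assumes sgn: "\<And>k. a k \<in> {- 1, 1}"
  shows "(continued_radical a)\<^sup>2 - 2 = continued_radical (\<lambda>k. a (Suc k))"
proof -
  let ?b = "\<lambda>k. a (Suc k)"
  have lim: "nested_radical c \<longlonglongrightarrow> continued_radical c"
    if "\<And>k. c k \<in> {- 1, 1}" for c :: "nat \<Rightarrow> real"
    using convergent_nested_radical[OF that] by (simp add: convergent_LIMSEQ_iff continued_radical_def)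
  have eq: "(nested_radical a (Suc m))\<^sup>2 - 2 = nested_radical ?b m" for m
  proof -
    \<comment> \<open>Makes the radicand nonnegative, so that squaring really undoes
      \<open>sqrt\<close>.\<close>
    have "\<bar>nested_radical ?b m\<bar> \<le> 2"
      using sgn by (intro nested_radical_bound)
    moreover have "(a 0)\<^sup>2 = 1"
      using sgn[of 0] by auto
    ultimately show ?thesis by (simp add: power_mult_distrib)
  qed
  have "(\<lambda>m. (nested_radical a (Suc m))\<^sup>2 - 2) \<longlonglongrightarrow> (continued_radical a)\<^sup>2 - 2"
    using LIMSEQ_Suc[OF lim[OF sgn]] by (intro tendsto_intros)
  then have "nested_radical ?b \<longlonglongrightarrow> (continued_radical a)\<^sup>2 - 2"
    unfolding eq .
  then show ?thesis
    using lim[of ?b] sgn LIMSEQ_unique by blast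
qed

lemma funpow_continued_radical:
  assumes "\<And>k. a k \<in> {- 1, 1}"
  shows "((\<lambda>x. x\<^sup>2 - 2) ^^ n) (continued_radical a) = continued_radical (\<lambda>k. a (n + k))"
proof (induction n)
  case (Suc n)
  then show ?case
    using continued_radical_square[of "\<lambda>k. a (n + k)"] assms by simp
qed simp

lemma Chebyshev_T_eqI:
  assumes "\<And>\<theta>. poly p (cos \<theta>) = cos (real N * \<theta>)"
  shows "Chebyshev_T N = p"
  using Chebyshev_T_ex1[of N] Chebyshev_T_cos[of N] assms by blast

text \<open>Doubling the angle gives T_(2N) = 2 T_N^2 - 1, that is, 2 T_(2N) = (2 T_N)^2 - 2. This
  is an identity of polynomials, so \<open>t\<close> need not lie in [-1, 1].\<close>

lemma Chebyshev_T_two_power: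
  "2 * poly (Chebyshev_T (2 ^ n)) t = ((\<lambda>x. x\<^sup>2 - 2) ^^ n) (2 * t)"
proof (induction n)
  case 0
  have "Chebyshev_T 1 = [:0, 1:]"
    by (rule Chebyshev_T_eqI) simp
  then show ?case by simp
next
  case (Suc n)
  have "Chebyshev_T (2 ^ Suc n) = 2 * (Chebyshev_T (2 ^ n))\<^sup>2 - 1"
  proof (rule Chebyshev_T_eqI)
    fix \<theta> :: real
    show "poly (2 * (Chebyshev_T (2 ^ n))\<^sup>2 - 1) (cos \<theta>) = cos (real (2 ^ Suc n) * \<theta>)"
      using cos_double_cos[of "2 ^ n * \<theta>"] by (simp add: Chebyshev_T_cos mult.assoc)
  qed
  then show ?case
    by (simp add: Suc.IH[symmetric] power_mult_distrib)
qed

text \<open>Outside [-2, 2] the map strictly increases absolute values, so no orbit starting there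
  returns. This excludes fixed points that are not of the form 2 cos \<theta>.\<close>

lemma funpow_square_minus_2_fixed_bound:
  fixes x :: real
  assumes "((\<lambda>x. x\<^sup>2 - 2) ^^ n) x = x" "n \<ge> 1"
  shows "\<bar>x\<bar> \<le> 2"
proof (rule ccontr)
  assume "\<not> \<bar>x\<bar> \<le> 2"
  have grow: "\<bar>y\<bar> < y\<^sup>2 - 2" if "2 < \<bar>y\<bar>" for y :: real
  proof -
    \<comment> \<open>The product equals y^2 - 2 - |y|.\<close>
    have "0 < (\<bar>y\<bar> - 2) * (\<bar>y\<bar> + 1)"
      using that by (intro mult_pos_pos) auto
    then show ?thesis by (simp add: algebra_simps power2_eq_square)
  qed
  have "\<bar>x\<bar> < ((\<lambda>x. x\<^sup>2 - 2) ^^ n) x"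
    using \<open>n \<ge> 1\<close>
  proof (induction n rule: dec_induct)
    case base
    then show ?case using grow \<open>\<not> \<bar>x\<bar> \<le> 2\<close> by simp
  next
    case (step n)
    then show ?case
      using \<open>\<not> \<bar>x\<bar> \<le> 2\<close> grow[of "((\<lambda>x. x\<^sup>2 - 2) ^^ n) x"] by simp
  qed
  then show False using assms(1) by simp
qed

lemma periodic_extension_sign:
  assumes "a \<in> sign_tuples n" "n \<ge> 1"
  shows "periodic_extension n a k \<in> {- 1, 1}"
  using assms PiE_mem[of a "{..<n}" "\<lambda>_. {- 1, 1}" "k mod n"]
  by (simp add: sign_tuples_def periodic_extension_def)

lemma fixed_point_continued_radical:
  fixes x :: real
  assumes fixed: "((\<lambda>x. x\<^sup>2 - 2) ^^ n) x = x" and n: "n \<ge> 1"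
  obtains a where "a \<in> sign_tuples n" "continued_radical (periodic_extension n a) = x"
proof
  define y where "y k = ((\<lambda>x. x\<^sup>2 - 2) ^^ k) x" for k
  \<comment> \<open>The signs of the orbit, with 0 counted as positive; \<open>restrict\<close>
    gives the extensional function that \<open>sign_tuples\<close> demands.\<close>
  define a where "a = restrict (\<lambda>k. if y k < 0 then - 1 else 1 :: real) {..<n}"
  show a: "a \<in> sign_tuples n"
    unfolding a_def sign_tuples_def by auto
  have "y (k mod n) = y k" for k
    unfolding y_def using fixed by (rule funpow_mod_eq)
  then have ext: "periodic_extension n a k = (if y k < 0 then - 1 else 1)" for k
    using n by (simp add: periodic_extension_def a_def)
  \<comment> \<open>Every orbit point is again fixed by the \<open>n\<close>-th iterate, so the
    bound for fixed points applies along the whole orbit.\<close>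
  have "((\<lambda>x. x\<^sup>2 - 2) ^^ n) (y k) = y k" for k
    using fixed unfolding y_def by (metis add.commute comp_apply funpow_add)
  then have bound: "\<bar>y k\<bar> \<le> 2" for k
    using funpow_square_minus_2_fixed_bound n by blast
  have "y k = periodic_extension n a k * sqrt (2 + y (Suc k))" for k
  proof -
    \<comment> \<open>Hence the root is |y k|, and the chosen sign restores \<open>y k\<close>; at 0
      either sign would do.\<close>
    have "2 + y (Suc k) = (y k)\<^sup>2" by (simp add: y_def)
    then show ?thesis by (simp add: ext)
  qed
  then have "continued_radical (periodic_extension n a) = y 0"
    using periodic_extension_sign[OF a n] bound by (intro continued_radical_eqI)
  then show "continued_radical (periodic_extension n a) = x"
    by (simp add: y_def)
qed

theorem mainTheorem2:
  fixes n :: nat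
  assumes "n \<ge> 1"
  shows "(\<forall>a \<in> sign_tuples n. convergent (nested_radical (periodic_extension n a))) \<and>
    {continued_radical (periodic_extension n a) | a. a \<in> sign_tuples n}
      = {2 * t | t :: real. poly (Chebyshev_T (2 ^ n)) t = t}"
proof (intro conjI ballI set_eqI iffI)
  fix a
  assume "a \<in> sign_tuples n"
  then show "convergent (nested_radical (periodic_extension n a))"
    using assms by (intro convergent_nested_radical periodic_extension_sign)
next
  fix x
  assume "x \<in> {continued_radical (periodic_extension n a) | a. a \<in> sign_tuples n}"
  then obtain a where a: "a \<in> sign_tuples n" and x: "x = continued_radical (periodic_extension n a)"
    by blast
  \<comment> \<open>Each iteration drops one sign, and dropping a whole period leaves the sequence
    unchanged.\<close>
  have "((\<lambda>x. x\<^sup>2 - 2) ^^ n) x = x"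
    using funpow_continued_radical[OF periodic_extension_sign[OF a assms], of n]
    by (simp add: x periodic_extension_add)
  then have "poly (Chebyshev_T (2 ^ n)) (x / 2) = x / 2"
    using Chebyshev_T_two_power[of n "x / 2"] by simp
  then show "x \<in> {2 * t | t. poly (Chebyshev_T (2 ^ n)) t = t}"
    by (intro CollectI exI[of _ "x / 2"]) simp
next
  fix x
  assume "x \<in> {2 * t | t. poly (Chebyshev_T (2 ^ n)) t = t}"
  then have "((\<lambda>x. x\<^sup>2 - 2) ^^ n) x = x"
    using Chebyshev_T_two_power[of n "x / 2"] by auto
  then show "x \<in> {continued_radical (periodic_extension n a) | a. a \<in> sign_tuples n}"
    using fixed_point_continued_radical[OF _ assms] by blast
qed

end
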